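(* Let $E$ be a compact metric space, $X=E^{\mathbb{N}}$, let $p$ be a Borel probability measure on $E$ with full support, let $f:X\to\mathbb{R}$ be a continuous potential, and let $\nu\in\mathscr{G}^{*}(f)$. Let $\xi_{f}\in L^1(\nu)^{**}$ be an eigenvector of $\mathbb{L}_{f}^{**}$, $\mathbb{L}_{f}^{**}\xi_f=\rho(\mathscr{L}_f)\xi_f$, which is the weak-$*$ limit of some convergent subnet of the sequence $\xi_n=\rho(\mathscr{L}_f)^{-n}J(\mathbb{L}_f^n(1))$, $n\in\mathbb{N}$, where $J:L^1(\nu)\to L^1(\nu)^{**}$ is the canonical map, and let $\mu$ be the set function on $\mathscr{B}(X)$ given by $\mu(A)=\xi_{f}(1_{A}\nu)$. Assume that $\mu$ is a (countably additive) probability measure. Then $\mu\ll\nu$ and the Radon-Nikodym derivative $d\mu/d\nu$ is an eigenfunction of $\mathbb{L}_f$ associated to $\rho(\mathscr{L}_{f})$: $$\mathbb{L}_{f}\frac{d\mu}{d\nu}=\rho(\mathscr{L}_{f})\frac{d\mu}{d\nu}\quad\text{in } L^1(\nu).$$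
   Context: $X=E^{\mathbb{N}}$ carries the product topology (which is compact metrizable) and its Borel $\sigma$-algebra $\mathscr{B}(X)$; $C(X)$ is the Banach space of real continuous functions on $X$ with the sup norm. For $a\in E$ and $x=(x_1,x_2,\ldots)\in X$, $ax=(a,x_1,x_2,\ldots)$. The a priori measure $p$ is a fixed Borel probability measure on $E$ with $\mathrm{supp}(p)=E$. The Ruelle operator $\mathscr{L}_f:C(X)\to C(X)$ is $\mathscr{L}_{f}\varphi(x)=\int_{E}\exp(f(ax))\varphi(ax)\,dp(a)$, and $\rho(\mathscr{L}_f)$ is its spectral radius on $(C(X),\|\cdot\|_\infty)$. Let $\mathscr{M}_s(X)\cong C(X)^*$ be the space of finite signed Borel measures on $X$ and $\mathscr{M}_1(X)$ the set of Borel probability measures on $X$. The transpose $\mathscr{L}_f^*$ acts on $\mathscr{M}_s(X)$ by $\int_X\varphi\,d[\mathscr{L}_f^*\mu]=\int_X\mathscr{L}_f\varphi\,d\mu$ for all $\varphi\in C(X)$. Define $\mathscr{G}^{*}(f)=\{\nu\in\mathscr{M}_1(X):\mathscr{L}_{f}^{*}\nu=\rho(\mathscr{L}_{f})\nu\}$. Since $p$ has full support, every $\nu\in\mathscr{G}^*(f)$ has full support, so $C(X)$ embeds in $L^1(\nu)=L^1(X,\mathscr{B}(X),\nu)$; $\mathbb{L}_f:L^1(\nu)\to L^1(\nu)$ denotes the bounded positive linear operator extending $\mathscr{L}_f$, i.e. $\mathbb{L}_f[\varphi]_\nu=[\mathscr{L}_f\varphi]_\nu$ for all $\varphi\in C(X)$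 (it exists, and is unique by density of $C(X)$). Its transpose is $\mathbb{L}_f^*:L^1(\nu)^*\to L^1(\nu)^*$, $\mathbb{L}_f^*\ell=\ell\circ\mathbb{L}_f$, and its double transpose $\mathbb{L}_f^{**}:L^1(\nu)^{**}\to L^1(\nu)^{**}$ is $(\mathbb{L}_f^{**}\xi)(\ell)=\xi(\mathbb{L}_f^*\ell)$. The canonical map is $J(\varphi)(\ell)=\ell(\varphi)$. The weak-$*$ topology on $L^1(\nu)^{**}$ is that of pointwise convergence on $L^1(\nu)^*$. For $A\in\mathscr{B}(X)$, $1_A\nu$ denotes the element of $L^1(\nu)^*$ given by $\varphi\mapsto\int_X 1_A\varphi\,d\nu$. *)

theory Defs
  imports "HOL-Probability.Probability"
begin

text \<open>
  The spectrum of an operator \<open>T\<close> on a real Banach space is the spectrum of its complexification.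
  The complexified space is \<open>'v \<times> 'v\<close>, where \<open>(u, v)\<close> stands for \<open>u + \<i>v\<close>. The product norm is
  equivalent to the usual complexification norms, so it yields the same bounded inverses. A real
  linear two-sided inverse of a complex linear map is complex linear.
\<close>

definition cscale :: "complex \<Rightarrow> 'v::real_normed_vector \<times> 'v \<Rightarrow> 'v \<times> 'v" where
  "cscale z w = (Re z *\<^sub>R fst w - Im z *\<^sub>R snd w, Im z *\<^sub>R fst w + Re z *\<^sub>R snd w)"

definition complexify :: "('v \<Rightarrow> 'v) \<Rightarrow> 'v::real_normed_vector \<times> 'v \<Rightarrow> 'v \<times> 'v" where
  "complexify T = map_prod T T"

definition spectrum :: "('v::real_normed_vector \<Rightarrow> 'v) \<Rightarrow> complex set" where
  "spectrum T = {z. \<not> (\<exists>S. bounded_linear S \<and>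
      (\<forall>w. S (cscale z w - complexify T w) = w) \<and>
      (\<forall>w. cscale z (S w) - complexify T (S w) = w))}"

definition spectral_radius :: "('v::real_normed_vector \<Rightarrow> 'v) \<Rightarrow> real" where
  "spectral_radius T = (SUP z\<in>spectrum T. cmod z)"

text \<open>
  The sequence \<open>(x\<^sub>1, x\<^sub>2, \<dots>)\<close> is the function \<open>x :: nat \<Rightarrow> 'a\<close> with \<open>x 0 = x\<^sub>1\<close>, so the
  sequence \<open>ax\<close> is \<open>case_nat a x\<close>. As \<open>X\<close> is compact, \<open>C(X)\<close> is the type of bounded continuous
  functions.
\<close>

definition measure_support :: "'a::topological_space measure \<Rightarrow> 'a set" where
  "measure_support p = {x. \<forall>U. open U \<and> x \<in> U \<longrightarrow> emeasure p U > 0}"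

definition ruelle_fun ::
    "'a measure \<Rightarrow> ((nat \<Rightarrow> 'a) \<Rightarrow> real) \<Rightarrow> ((nat \<Rightarrow> 'a) \<Rightarrow> real) \<Rightarrow> (nat \<Rightarrow> 'a) \<Rightarrow> real" where
  "ruelle_fun p f \<phi> x = (\<integral>a. exp (f (case_nat a x)) * \<phi> (case_nat a x) \<partial>p)"

definition ruelle ::
    "'a::metric_space measure \<Rightarrow> ((nat \<Rightarrow> 'a) \<Rightarrow> real) \<Rightarrow> ((nat \<Rightarrow> 'a) \<Rightarrow>\<^sub>C real) \<Rightarrow> ((nat \<Rightarrow> 'a) \<Rightarrow>\<^sub>C real)"
  where "ruelle p f \<phi> = Bcontfun (ruelle_fun p f (apply_bcontfun \<phi>))"

lemma compact_UNIV_seq: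
  assumes "compact (UNIV :: 'a::metric_space set)"
  shows "compact (UNIV :: (nat \<Rightarrow> 'a) set)"
proof -
  have "compact_space (product_topology (\<lambda>_::nat. euclidean :: 'a topology) UNIV)"
    unfolding compact_space_product_topology using assms by (simp add: compact_space_def)
  then show ?thesis
    unfolding euclidean_product_topology by (simp add: compact_space_def)
qed

lemma continuous_on_case_nat_pair:
  "continuous_on UNIV (\<lambda>z :: 'a::topological_space \<times> (nat \<Rightarrow> 'a). case_nat (fst z) (snd z))"
proof (rule continuous_on_coordinatewise_then_product)
  fix i
  show "continuous_on UNIV (\<lambda>z :: 'a \<times> (nat \<Rightarrow> 'a). case_nat (fst z) (snd z) i)"
  proof (cases i)
    case 0
    then show ?thesis by (simp add: continuous_on_fst)
  next
    case (Suc j)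
    have "continuous_on UNIV (\<lambda>z :: 'a \<times> (nat \<Rightarrow> 'a). snd z j)"
      by (rule continuous_on_product_then_coordinatewise) (intro continuous_intros)
    with Suc show ?thesis by simp
  qed
qed

text \<open>\<open>Bcontfun\<close> in the definition of \<open>ruelle\<close> is only applied to elements of \<open>C(X)\<close>.\<close>

lemma ruelle_fun_bcontfun:
  fixes p :: "'a::metric_space measure" and f :: "(nat \<Rightarrow> 'a) \<Rightarrow> real"
  assumes comp: "compact (UNIV :: 'a set)" and "prob_space p" and sets_p: "sets p = sets borel"
    and f: "continuous_on UNIV f" and \<phi>: "continuous_on UNIV \<phi>"
  shows "ruelle_fun p f \<phi> \<in> bcontfun"
proof -
  interpret prob_space p by fact
  define g where "g y = exp (f y) * \<phi> y" for y
  have g: "continuous_on UNIV g"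
    unfolding g_def by (intro continuous_intros f \<phi>)
  have "bounded (range g)"
    using compact_continuous_image[OF g compact_UNIV_seq[OF comp]] by (rule compact_imp_bounded)
  then obtain B where B: "\<And>y. \<bar>g y\<bar> \<le> B"
    by (auto simp: bounded_iff)
  have g_pair: "continuous_on UNIV (\<lambda>z. g (case_nat (fst z) (snd z)))"
    using continuous_on_compose2[OF g continuous_on_case_nat_pair] by simp
  have meas: "(\<lambda>a. g (case_nat a x)) \<in> borel_measurable p" for x
  proof -
    have "continuous_on UNIV (\<lambda>a. g (case_nat (fst (a, x)) (snd (a, x))))"
      by (rule continuous_on_compose2[OF g_pair]) (auto intro!: continuous_intros)
    then have "(\<lambda>a. g (case_nat a x)) \<in> borel_measurable borel"
      by (simp add: borel_measurable_continuous_onI)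
    then show ?thesis
      using sets_p by (simp cong: measurable_cong_sets)
  qed
  have int: "integrable p (\<lambda>a. g (case_nat a x))" for x
    by (rule integrable_const_bound[where B = B]) (use B meas in auto)
  have eq: "ruelle_fun p f \<phi> x = (\<integral>a. g (case_nat a x) \<partial>p)" for x
    by (simp add: ruelle_fun_def g_def)
  show ?thesis
  proof (rule bcontfun_normI)
    show "norm (ruelle_fun p f \<phi> x) \<le> B" for x
    proof -
      have "\<bar>\<integral>a. g (case_nat a x) \<partial>p\<bar> \<le> (\<integral>a. \<bar>g (case_nat a x)\<bar> \<partial>p)"
        using integral_norm_bound[of p "\<lambda>a. g (case_nat a x)"] by simp
      also have "\<dots> \<le> (\<integral>a. B \<partial>p)"
        using int B by (intro integral_mono) auto
      finally show ?thesis
        by (simp add: eq prob_space)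
    qed
    show "continuous_on UNIV (ruelle_fun p f \<phi>)"
      unfolding continuous_on_sequentially
    proof (safe, goal_cases)
      case (1 u x)
      have "(\<lambda>n. \<integral>a. g (case_nat a (u n)) \<partial>p) \<longlonglongrightarrow> (\<integral>a. g (case_nat a x) \<partial>p)"
      proof (rule integral_dominated_convergence[where w = "\<lambda>_. B"])
        show "AE a in p. (\<lambda>n. g (case_nat a (u n))) \<longlonglongrightarrow> g (case_nat a x)"
        proof (rule AE_I2)
          fix a :: 'a
          have "u \<longlonglongrightarrow> x"
            using 1 by blast
          then have "((\<lambda>n. (a, u n)) \<longlongrightarrow> (a, x)) sequentially"
            by (intro tendsto_intros)
          from continuous_on_tendsto_compose[OF g_pair this]
          show "(\<lambda>n. g (case_nat a (u n))) \<longlonglongrightarrow> g (case_nat a x)"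
            by simp
        qed
      qed (use B meas in auto)
      then show ?case
        by (simp add: eq o_def)
    qed
  qed
qed

lemma ruelle_apply:
  fixes p :: "'a::metric_space measure" and f :: "(nat \<Rightarrow> 'a) \<Rightarrow> real"
  assumes "compact (UNIV :: 'a set)" and "prob_space p" and "sets p = sets borel"
    and "continuous_on UNIV f"
  shows "apply_bcontfun (ruelle p f \<phi>) x
       = (\<integral>a. exp (f (case_nat a x)) * apply_bcontfun \<phi> (case_nat a x) \<partial>p)"
  using ruelle_fun_bcontfun[OF assms, of "apply_bcontfun \<phi>"]
  by (simp add: ruelle_def Bcontfun_inverse ruelle_fun_def)

text \<open>
  The equation in \<open>eigenmeasures\<close> says that the transpose of \<open>ruelle p f\<close> maps \<open>\<nu>\<close> to
  \<open>spectral_radius (ruelle p f) \<cdot> \<nu>\<close>, where signed measures are identified with functionals on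
  \<open>C(X)\<close>.
\<close>

definition eigenmeasures ::
    "'a::metric_space measure \<Rightarrow> ((nat \<Rightarrow> 'a) \<Rightarrow> real) \<Rightarrow> (nat \<Rightarrow> 'a) measure set" where
  "eigenmeasures p f = {\<nu>. prob_space \<nu> \<and> sets \<nu> = sets borel \<and>
      (\<forall>\<phi>. (\<integral>x. apply_bcontfun (ruelle p f \<phi>) x \<partial>\<nu>)
         = spectral_radius (ruelle p f) * (\<integral>x. apply_bcontfun \<phi> x \<partial>\<nu>))}"

text \<open>
  An element of \<open>L\<^sup>1(\<nu>)\<close> is represented by an integrable function, and equality in \<open>L\<^sup>1(\<nu>)\<close> is
  equality almost everywhere. Functionals and operators act on representatives. They may take
  arbitrary values outside the stated carrier, and only their values on it are ever constrained.
  No compatibility with equality in \<open>L\<^sup>1(\<nu>)\<close> needs to be required: a linear map that is bounded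
  with respect to the (semi)norm sends representatives of one element to representatives of one
  element, and the same argument applies one level up to the bidual.
\<close>

definition L1_norm :: "'x measure \<Rightarrow> ('x \<Rightarrow> real) \<Rightarrow> real" where
  "L1_norm \<nu> \<phi> = (\<integral>x. \<bar>\<phi> x\<bar> \<partial>\<nu>)"

definition L1_dual :: "'x measure \<Rightarrow> (('x \<Rightarrow> real) \<Rightarrow> real) set" where
  "L1_dual \<nu> = {l.
      (\<forall>\<phi> \<psi> a b. integrable \<nu> \<phi> \<longrightarrow> integrable \<nu> \<psi> \<longrightarrow>
         l (\<lambda>x. a * \<phi> x + b * \<psi> x) = a * l \<phi> + b * l \<psi>) \<and>
      (\<exists>C. \<forall>\<phi>. integrable \<nu> \<phi> \<longrightarrow> \<bar>l \<phi>\<bar> \<le> C * L1_norm \<nu> \<phi>)}"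

definition L1_dual_norm :: "'x measure \<Rightarrow> (('x \<Rightarrow> real) \<Rightarrow> real) \<Rightarrow> real" where
  "L1_dual_norm \<nu> l = (SUP \<phi>\<in>{\<phi>. integrable \<nu> \<phi> \<and> L1_norm \<nu> \<phi> \<le> 1}. \<bar>l \<phi>\<bar>)"

definition L1_bidual :: "'x measure \<Rightarrow> ((('x \<Rightarrow> real) \<Rightarrow> real) \<Rightarrow> real) set" where
  "L1_bidual \<nu> = {\<xi>.
      (\<forall>l\<in>L1_dual \<nu>. \<forall>m\<in>L1_dual \<nu>. \<forall>a b.
         \<xi> (\<lambda>\<phi>. a * l \<phi> + b * m \<phi>) = a * \<xi> l + b * \<xi> m) \<and>
      (\<exists>C. \<forall>l\<in>L1_dual \<nu>. \<bar>\<xi> l\<bar> \<le> C * L1_dual_norm \<nu> l)}"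

definition canonical_J :: "('x \<Rightarrow> real) \<Rightarrow> (('x \<Rightarrow> real) \<Rightarrow> real) \<Rightarrow> real" where
  "canonical_J \<phi> = (\<lambda>l. l \<phi>)"

text \<open>At \<open>L :: L\<^sup>1 \<Rightarrow> L\<^sup>1\<close> this is the transpose, at the transpose of \<open>L\<close> the double transpose.\<close>

definition transpose_op :: "('u \<Rightarrow> 'u) \<Rightarrow> ('u \<Rightarrow> real) \<Rightarrow> 'u \<Rightarrow> real" where
  "transpose_op L l = l \<circ> L"

definition indicator_functional :: "'x measure \<Rightarrow> 'x set \<Rightarrow> ('x \<Rightarrow> real) \<Rightarrow> real" where
  "indicator_functional \<nu> A \<phi> = (\<integral>x. indicator A x * \<phi> x \<partial>\<nu>)"

text \<open>\<open>L\<close> is (a representative of) the bounded positive linear extension of \<open>T\<close> to \<open>L\<^sup>1(\<nu>)\<close>.\<close>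

definition is_L1_extension ::
    "'x::topological_space measure \<Rightarrow> (('x \<Rightarrow>\<^sub>C real) \<Rightarrow> ('x \<Rightarrow>\<^sub>C real)) \<Rightarrow>
     (('x \<Rightarrow> real) \<Rightarrow> ('x \<Rightarrow> real)) \<Rightarrow> bool" where
  "is_L1_extension \<nu> T L \<longleftrightarrow>
      (\<forall>\<phi>. integrable \<nu> \<phi> \<longrightarrow> integrable \<nu> (L \<phi>)) \<and>
      (\<forall>\<phi> \<psi> a b. integrable \<nu> \<phi> \<longrightarrow> integrable \<nu> \<psi> \<longrightarrow>
         (AE x in \<nu>. L (\<lambda>y. a * \<phi> y + b * \<psi> y) x = a * L \<phi> x + b * L \<psi> x)) \<and>
      (\<exists>C. \<forall>\<phi>. integrable \<nu> \<phi> \<longrightarrow> L1_norm \<nu> (L \<phi>) \<le> C * L1_norm \<nu> \<phi>) \<and>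
      (\<forall>\<phi>. integrable \<nu> \<phi> \<longrightarrow> (AE x in \<nu>. 0 \<le> \<phi> x) \<longrightarrow> (AE x in \<nu>. 0 \<le> L \<phi> x)) \<and>
      (\<forall>\<phi>. AE x in \<nu>. L (apply_bcontfun \<phi>) x = apply_bcontfun (T \<phi>) x)"

text \<open>Eigenvectors are nonzero.\<close>

definition L1_eigenvector ::
    "'x measure \<Rightarrow> (('x \<Rightarrow> real) \<Rightarrow> ('x \<Rightarrow> real)) \<Rightarrow> real \<Rightarrow> ('x \<Rightarrow> real) \<Rightarrow> bool" where
  "L1_eigenvector \<nu> L r h \<longleftrightarrow> integrable \<nu> h \<and> \<not> (AE x in \<nu>. h x = 0) \<and>
      (AE x in \<nu>. L h x = r * h x)"

definition L1_bidual_eigenvector ::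
    "'x measure \<Rightarrow> (('x \<Rightarrow> real) \<Rightarrow> ('x \<Rightarrow> real)) \<Rightarrow> real \<Rightarrow>
     ((('x \<Rightarrow> real) \<Rightarrow> real) \<Rightarrow> real) \<Rightarrow> bool" where
  "L1_bidual_eigenvector \<nu> L r \<xi> \<longleftrightarrow> \<xi> \<in> L1_bidual \<nu> \<and> (\<exists>l\<in>L1_dual \<nu>. \<xi> l \<noteq> 0) \<and>
      (\<forall>l\<in>L1_dual \<nu>. transpose_op (transpose_op L) \<xi> l = r * \<xi> l)"

definition directed_set :: "'d set \<Rightarrow> ('d \<Rightarrow> 'd \<Rightarrow> bool) \<Rightarrow> bool" where
  "directed_set D le \<longleftrightarrow> D \<noteq> {} \<and> (\<forall>d\<in>D. le d d) \<and>
      (\<forall>c\<in>D. \<forall>d\<in>D. \<forall>e\<in>D. le c d \<longrightarrow> le d e \<longrightarrow> le c e) \<and>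
      (\<forall>c\<in>D. \<forall>d\<in>D. \<exists>e\<in>D. le c e \<and> le d e)"

text \<open>
  The net \<open>d \<mapsto> s (k d)\<close> on \<open>D\<close> is a subnet (in the sense of Kelley, so \<open>k\<close> need not be monotone)
  of a sequence \<open>s\<close>.
\<close>

definition subnet_index :: "'d set \<Rightarrow> ('d \<Rightarrow> 'd \<Rightarrow> bool) \<Rightarrow> ('d \<Rightarrow> nat) \<Rightarrow> bool" where
  "subnet_index D le k \<longleftrightarrow> directed_set D le \<and> (\<forall>n. \<exists>d\<in>D. \<forall>e\<in>D. le d e \<longrightarrow> n \<le> k e)"

definition net_tails :: "'d set \<Rightarrow> ('d \<Rightarrow> 'd \<Rightarrow> bool) \<Rightarrow> 'd filter" where
  "net_tails D le = (INF d\<in>D. principal {e\<in>D. le d e})"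

definition weak_star_tendsto ::
    "'x measure \<Rightarrow> ('d \<Rightarrow> (('x \<Rightarrow> real) \<Rightarrow> real) \<Rightarrow> real) \<Rightarrow> ((('x \<Rightarrow> real) \<Rightarrow> real) \<Rightarrow> real) \<Rightarrow>
     'd filter \<Rightarrow> bool" where
  "weak_star_tendsto \<nu> \<eta> \<xi> F \<longleftrightarrow> (\<forall>l\<in>L1_dual \<nu>. ((\<lambda>d. \<eta> d l) \<longlongrightarrow> \<xi> l) F)"

definition normalized_iterate ::
    "real \<Rightarrow> (('x \<Rightarrow> real) \<Rightarrow> ('x \<Rightarrow> real)) \<Rightarrow> nat \<Rightarrow> (('x \<Rightarrow> real) \<Rightarrow> real) \<Rightarrow> real" where
  "normalized_iterate r L n = (\<lambda>l. inverse (r ^ n) * canonical_J ((L ^^ n) (\<lambda>_. 1)) l)"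

end

theory Submission
  imports Defs
begin

text \<open>
  Countable additivity of \<open>\<mu>\<close> forces \<open>\<xi>\<close> to lie in the image of \<open>L\<^sup>1(\<nu>)\<close>: with \<open>h = d\<mu>/d\<nu>\<close>, the
  functionals \<open>\<xi>\<close> and \<open>J(h)\<close> agree on \<open>1\<^sub>A\<nu>\<close>, hence on simple densities, hence by norm density on
  \<open>L\<^sup>\<infinity>(\<nu>) = L\<^sup>1(\<nu>)\<^sup>*\<close>. The eigenvalue equation for \<open>\<xi>\<close>, evaluated at the functionals \<open>1\<^sub>A\<nu>\<close>, then
  says that \<open>L h\<close> and \<open>\<rho> h\<close> have the same integral over every Borel set.
\<close>

section \<open>Bounded functionals on \<open>L^1\<close> and their action on representatives\<close>

text \<open>For measurable, essentially bounded \<open>g\<close> this is the image of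
  \<open>g\<close> under the embedding of \<open>L^\<infinity>\<close> into the dual of
  \<open>L^1\<close>; it turns questions about functionals into questions about functions.\<close>

definition density_functional :: "'x measure \<Rightarrow> ('x \<Rightarrow> real) \<Rightarrow> ('x \<Rightarrow> real) \<Rightarrow> real" where
  "density_functional M g \<phi> = (\<integral>x. g x * \<phi> x \<partial>M)"

lemma indicator_functional_eq: "indicator_functional M A = density_functional M (indicator A)"
  by (simp add: fun_eq_iff indicator_functional_def density_functional_def)

lemma L1_norm_nonneg: "0 \<le> L1_norm M \<phi>"
  by (simp add: L1_norm_def)

lemma L1_dual_linear:
  assumes "l \<in> L1_dual M" "integrable M \<phi>" "integrable M \<psi>"
  shows "l (\<lambda>x. a * \<phi> x + b * \<psi> x) = a * l \<phi> + b * l \<psi>"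
  using assms by (simp add: L1_dual_def)

lemma L1_dual_add:
  assumes "l \<in> L1_dual M" "integrable M \<phi>" "integrable M \<psi>"
  shows "l (\<lambda>x. \<phi> x + \<psi> x) = l \<phi> + l \<psi>"
  using L1_dual_linear[OF assms, of 1 1] by simp

lemma L1_dual_diff:
  assumes "l \<in> L1_dual M" "integrable M \<phi>" "integrable M \<psi>"
  shows "l (\<lambda>x. \<phi> x - \<psi> x) = l \<phi> - l \<psi>"
  using L1_dual_linear[OF assms, of 1 "-1"] by simp

lemma L1_dual_scale:
  assumes "l \<in> L1_dual M" "integrable M \<phi>"
  shows "l (\<lambda>x. a * \<phi> x) = a * l \<phi>"
  using L1_dual_linear[OF assms assms(2), of a 0] by simp

text \<open>\<open>L1_dual\<close> does not fix the sign of the bounding constant. Because the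
  seminorm is nonnegative, the absolute value of the constant is a bound too, and inequalities can
  then be multiplied by it.\<close>

lemma L1_dual_bound:
  assumes "l \<in> L1_dual M"
  obtains C where "0 \<le> C" "\<And>\<phi>. integrable M \<phi> \<Longrightarrow> \<bar>l \<phi>\<bar> \<le> C * L1_norm M \<phi>"
proof -
  obtain C where C: "\<And>\<phi>. integrable M \<phi> \<Longrightarrow> \<bar>l \<phi>\<bar> \<le> C * L1_norm M \<phi>"
    using assms by (auto simp: L1_dual_def)
  have "\<bar>l \<phi>\<bar> \<le> \<bar>C\<bar> * L1_norm M \<phi>" if "integrable M \<phi>" for \<phi>
    using C[OF that] mult_right_mono[OF abs_ge_self[of C] L1_norm_nonneg[of M \<phi>]] by linarith
  then show ?thesis
    using that[of "\<bar>C\<bar>"] by auto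
qed

text \<open>The difference of two representatives of one class has seminorm zero, so boundedness
  forces equal values on them.\<close>

lemma L1_dual_cong_AE:
  assumes l: "l \<in> L1_dual M" and int: "integrable M \<phi>" "integrable M \<psi>"
    and eq: "AE x in M. \<phi> x = \<psi> x"
  shows "l \<phi> = l \<psi>"
proof -
  obtain C where C: "\<And>\<phi>. integrable M \<phi> \<Longrightarrow> \<bar>l \<phi>\<bar> \<le> C * L1_norm M \<phi>"
    using l by (rule L1_dual_bound) blast
  have "L1_norm M (\<lambda>x. \<phi> x - \<psi> x) = 0"
    unfolding L1_norm_def by (rule integral_eq_zero_AE) (use eq in auto)
  with C[of "\<lambda>x. \<phi> x - \<psi> x"] show ?thesis
    using int by (simp add: L1_dual_diff[OF l])
qed

lemma L1_dual_lincomb: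
  assumes l: "l \<in> L1_dual M" and m: "m \<in> L1_dual M"
  shows "(\<lambda>\<phi>. a * l \<phi> + b * m \<phi>) \<in> L1_dual M"
proof -
  obtain C where C: "\<And>\<phi>. integrable M \<phi> \<Longrightarrow> \<bar>l \<phi>\<bar> \<le> C * L1_norm M \<phi>"
    using l by (rule L1_dual_bound) blast
  obtain K where K: "\<And>\<phi>. integrable M \<phi> \<Longrightarrow> \<bar>m \<phi>\<bar> \<le> K * L1_norm M \<phi>"
    using m by (rule L1_dual_bound) blast
  have "\<bar>a * l \<phi> + b * m \<phi>\<bar> \<le> (\<bar>a\<bar> * C + \<bar>b\<bar> * K) * L1_norm M \<phi>" if "integrable M \<phi>" for \<phi>
  proof -
    have "\<bar>a * l \<phi> + b * m \<phi>\<bar> \<le> \<bar>a\<bar> * \<bar>l \<phi>\<bar> + \<bar>b\<bar> * \<bar>m \<phi>\<bar>"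
      by (metis abs_mult abs_triangle_ineq)
    also have "\<dots> \<le> \<bar>a\<bar> * (C * L1_norm M \<phi>) + \<bar>b\<bar> * (K * L1_norm M \<phi>)"
      by (intro add_mono mult_left_mono C K that) auto
    finally show ?thesis by (simp add: algebra_simps)
  qed
  then have "\<exists>B. \<forall>\<phi>. integrable M \<phi> \<longrightarrow> \<bar>a * l \<phi> + b * m \<phi>\<bar> \<le> B * L1_norm M \<phi>"
    by blast
  moreover have "\<forall>\<phi> \<psi> c d. integrable M \<phi> \<longrightarrow> integrable M \<psi> \<longrightarrow>
      a * l (\<lambda>x. c * \<phi> x + d * \<psi> x) + b * m (\<lambda>x. c * \<phi> x + d * \<psi> x)
      = c * (a * l \<phi> + b * m \<phi>) + d * (a * l \<psi> + b * m \<psi>)"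
    by (simp add: L1_dual_linear[OF l] L1_dual_linear[OF m] algebra_simps)
  ultimately show ?thesis
    unfolding L1_dual_def by blast
qed

lemma L1_dual_zero: "(\<lambda>_. 0) \<in> L1_dual M"
  by (auto simp: L1_dual_def intro!: exI[of _ 0])

text \<open>Dominated convergence yields convergence in the \<open>L^1\<close> seminorm, along which
  a bounded functional is continuous.\<close>

lemma L1_dual_dominated_convergence:
  fixes \<phi> :: "'x \<Rightarrow> real"
  assumes l: "l \<in> L1_dual M" and s: "\<And>i. integrable M (s i)" and \<phi>: "integrable M \<phi>"
    and w: "integrable M w"
    and lim: "\<And>x. x \<in> space M \<Longrightarrow> (\<lambda>i. s i x) \<longlonglongrightarrow> \<phi> x"
    and bound: "\<And>i x. x \<in> space M \<Longrightarrow> \<bar>s i x\<bar> \<le> w x"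
  shows "(\<lambda>i. l (s i)) \<longlonglongrightarrow> l \<phi>"
proof -
  obtain C where C: "\<And>\<phi>. integrable M \<phi> \<Longrightarrow> \<bar>l \<phi>\<bar> \<le> C * L1_norm M \<phi>"
    using l by (rule L1_dual_bound) blast
  \<comment> \<open>By the triangle inequality \<open>w x + \<bar>\<phi> x\<bar>\<close> dominates
    the differences.\<close>
  have "(\<lambda>i. \<integral>x. \<bar>s i x - \<phi> x\<bar> \<partial>M) \<longlonglongrightarrow> (\<integral>x. 0 \<partial>M)"
  proof (rule integral_dominated_convergence[where w = "\<lambda>x. w x + \<bar>\<phi> x\<bar>"])
    show "AE x in M. (\<lambda>i. \<bar>s i x - \<phi> x\<bar>) \<longlonglongrightarrow> 0"
      by (rule AE_I2, rule tendsto_rabs_zero) (use lim LIM_zero in blast)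
    show "AE x in M. norm \<bar>s i x - \<phi> x\<bar> \<le> w x + \<bar>\<phi> x\<bar>" for i
    proof (rule AE_I2)
      fix x assume "x \<in> space M"
      then show "norm \<bar>s i x - \<phi> x\<bar> \<le> w x + \<bar>\<phi> x\<bar>"
        using bound[of x i] by auto
    qed
  qed (use s \<phi> w in auto)
  then have "(\<lambda>i. C * L1_norm M (\<lambda>x. s i x - \<phi> x)) \<longlonglongrightarrow> C * 0"
    by (intro tendsto_intros) (simp add: L1_norm_def)
  then have "(\<lambda>i. C * L1_norm M (\<lambda>x. s i x - \<phi> x)) \<longlonglongrightarrow> 0"
    by simp
  moreover have "\<forall>i. norm (l (s i) - l \<phi>) \<le> C * L1_norm M (\<lambda>x. s i x - \<phi> x)"
  proof
    fix i
    show "norm (l (s i) - l \<phi>) \<le> C * L1_norm M (\<lambda>x. s i x - \<phi> x)"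
      using C[of "\<lambda>x. s i x - \<phi> x"] s \<phi> by (simp add: L1_dual_diff[OF l])
  qed
  ultimately have "(\<lambda>i. l (s i) - l \<phi>) \<longlonglongrightarrow> 0"
    by (rule Lim_null_comparison[OF always_eventually, rotated])
  then show ?thesis
    by (rule LIM_zero_cancel)
qed

section \<open>Functionals with an essentially bounded density\<close>

lemma integrable_bounded_mult:
  fixes g \<phi> :: "'x \<Rightarrow> real"
  assumes "g \<in> borel_measurable M" "AE x in M. \<bar>g x\<bar> \<le> K" "integrable M \<phi>"
  shows "integrable M (\<lambda>x. g x * \<phi> x)"
proof (rule Bochner_Integration.integrable_bound)
  show "integrable M (\<lambda>x. K * \<phi> x)" using assms by simp
  show "AE x in M. norm (g x * \<phi> x) \<le> norm (K * \<phi> x)"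
    using assms(2) by eventually_elim (auto simp: abs_mult intro!: mult_right_mono)
qed (use assms in auto)

lemma density_functional_bound:
  assumes g: "g \<in> borel_measurable M" and K: "AE x in M. \<bar>g x\<bar> \<le> K" and \<phi>: "integrable M \<phi>"
  shows "\<bar>density_functional M g \<phi>\<bar> \<le> K * L1_norm M \<phi>"
proof -
  note int = integrable_bounded_mult[OF g K \<phi>]
  have "\<bar>\<integral>x. g x * \<phi> x \<partial>M\<bar> \<le> (\<integral>x. \<bar>g x * \<phi> x\<bar> \<partial>M)"
    using integral_norm_bound[of M "\<lambda>x. g x * \<phi> x"] by simp
  also have "\<dots> \<le> (\<integral>x. K * \<bar>\<phi> x\<bar> \<partial>M)"
  proof (rule integral_mono_AE)
    show "AE x in M. \<bar>g x * \<phi> x\<bar> \<le> K * \<bar>\<phi> x\<bar>"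
      using K by eventually_elim (auto simp: abs_mult intro!: mult_right_mono)
  qed (use int \<phi> in auto)
  finally show ?thesis
    by (simp add: density_functional_def L1_norm_def)
qed

lemma density_functional_L1_dual:
  assumes g: "g \<in> borel_measurable M" and K: "AE x in M. \<bar>g x\<bar> \<le> K"
  shows "density_functional M g \<in> L1_dual M"
proof -
  have "density_functional M g (\<lambda>x. a * \<phi> x + b * \<psi> x)
      = a * density_functional M g \<phi> + b * density_functional M g \<psi>"
    if "integrable M \<phi>" "integrable M \<psi>" for \<phi> \<psi> a b
  proof -
    note i = integrable_bounded_mult[OF g K that(1)] integrable_bounded_mult[OF g K that(2)]
    have "density_functional M g (\<lambda>x. a * \<phi> x + b * \<psi> x)
        = (\<integral>x. a * (g x * \<phi> x) + b * (g x * \<psi> x) \<partial>M)"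
      unfolding density_functional_def by (simp add: algebra_simps)
    also have "\<dots> = a * density_functional M g \<phi> + b * density_functional M g \<psi>"
      using i by (simp add: density_functional_def)
    finally show ?thesis .
  qed
  then show ?thesis
    using density_functional_bound[OF g K] by (auto simp: L1_dual_def)
qed

section \<open>The dual of \<open>L^1\<close> over a finite measure\<close>

context finite_measure
begin

text \<open>The seminorm of an indicator is the measure of its set. This estimate later gives both
  continuity and absolute continuity of the measure built from \<open>l\<close>.\<close>

lemma L1_dual_indicator_lipschitz:
  assumes bound: "\<And>\<phi>. integrable M \<phi> \<Longrightarrow> \<bar>l \<phi>\<bar> \<le> C * L1_norm M \<phi>" and A: "A \<in> sets M"
  shows "\<bar>l (indicator A)\<bar> \<le> C * measure M A"
proof -
  have "integrable M (indicator A :: _ \<Rightarrow> real)"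
    using A by (simp add: emeasure_finite less_top[symmetric])
  from bound[OF this] show ?thesis
    using A sets.sets_into_space[OF A] by (simp add: L1_norm_def Int_absorb2)
qed

text \<open>
  Adding \<open>C\<close> times the measure makes the functional nonnegative on indicators, so that no signed
  measure is needed.
\<close>

lemma L1_dual_shifted_measure:
  assumes l: "l \<in> L1_dual M" and C: "0 \<le> C"
    and bound: "\<And>\<phi>. integrable M \<phi> \<Longrightarrow> \<bar>l \<phi>\<bar> \<le> C * L1_norm M \<phi>"
  obtains N where "finite_measure N" "sets N = sets M"
    "\<And>A. A \<in> sets M \<Longrightarrow> measure N A = l (indicator A) + C * measure M A"
proof -
  define m where "m A = ennreal (l (indicator A) + C * measure M A)" for A
  have lip: "\<bar>l (indicator A)\<bar> \<le> C * measure M A" if "A \<in> sets M" for A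
    using bound that by (rule L1_dual_indicator_lipschitz)
  have ind: "integrable M (indicator A :: _ \<Rightarrow> real)" if "A \<in> sets M" for A
    using that by (simp add: emeasure_finite less_top[symmetric])
  have nonneg: "0 \<le> l (indicator A) + C * measure M A" if "A \<in> sets M" for A
    using lip[OF that] by linarith
  have le: "l (indicator A) + C * measure M A \<le> 2 * C * measure M A" if "A \<in> sets M" for A
    using lip[OF that] by linarith
  have pos: "positive (sets M) m"
    using lip[of "{}"] by (simp add: positive_def m_def)
  have add: "additive (sets M) m"
    unfolding additive_def
  proof (intro ballI impI)
    fix A B assume A: "A \<in> sets M" and B: "B \<in> sets M" and disj: "A \<inter> B = {}"
    have "l (indicator (A \<union> B)) = l (\<lambda>x. indicator A x + indicator B x)"
      by (rule arg_cong[where f = l]) (use disj in \<open>auto simp: fun_eq_iff indicator_def\<close>)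
    also have "\<dots> = l (indicator A) + l (indicator B)"
      by (rule L1_dual_add[OF l ind[OF A] ind[OF B]])
    finally show "m (A \<union> B) = m A + m B"
      using nonneg[OF A] nonneg[OF B] A B disj
      by (simp add: m_def finite_measure_Union algebra_simps flip: ennreal_plus)
  qed
  \<comment> \<open>For a finite additive set function, continuity at the empty set implies
    countable additivity. The values along a decreasing sequence are squeezed between 0 and
    \<open>2 * C * measure M (A i)\<close>.\<close>
  have ca: "countably_additive (sets M) m"
  proof (rule sets.empty_continuous_imp_countably_additive[OF pos add])
    show "\<forall>A\<in>sets M. m A \<noteq> \<infinity>" by (simp add: m_def)
    fix A :: "nat \<Rightarrow> _" assume A: "range A \<subseteq> sets M" "decseq A" "(\<Inter>i. A i) = {}"
    have "(\<lambda>i. measure M (A i)) \<longlonglongrightarrow> measure M (\<Inter>i. A i)"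
      using A(1,2) by (rule finite_Lim_measure_decseq)
    then have "(\<lambda>i. 2 * C * measure M (A i)) \<longlonglongrightarrow> 2 * C * 0"
      using A(3) by (intro tendsto_intros) simp
    then have lim: "(\<lambda>i. 2 * C * measure M (A i)) \<longlonglongrightarrow> 0"
      by simp
    have "\<forall>i. norm (l (indicator (A i)) + C * measure M (A i)) \<le> 2 * C * measure M (A i)"
    proof
      fix i
      have "A i \<in> sets M" using A(1) by auto
      from nonneg[OF this] le[OF this]
      show "norm (l (indicator (A i)) + C * measure M (A i)) \<le> 2 * C * measure M (A i)"
        by simp
    qed
    from Lim_null_comparison[OF always_eventually[OF this] lim]
    have "(\<lambda>i. l (indicator (A i)) + C * measure M (A i)) \<longlonglongrightarrow> 0" .
    then have "(\<lambda>i. m (A i)) \<longlonglongrightarrow> ennreal 0"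
      unfolding m_def by (rule tendsto_ennrealI)
    then show "(\<lambda>i. m (A i)) \<longlonglongrightarrow> 0" by simp
  qed
  define N where "N = measure_of (space M) (sets M) m"
  have sets_N: "sets N = sets M"
    by (simp add: N_def sets.sets_measure_of_eq)
  have em: "emeasure N A = m A" if "A \<in> sets M" for A
    unfolding N_def by (rule emeasure_measure_of_sigma[OF sets.sigma_algebra_axioms pos ca that])
  show ?thesis
  proof (rule that[OF _ sets_N])
    show "finite_measure N"
      by (rule finite_measureI)
        (simp add: em m_def sets_eq_imp_space_eq[OF sets_N])
    show "measure N A = l (indicator A) + C * measure M A" if "A \<in> sets M" for A
      using em[OF that] nonneg[OF that] by (simp add: measure_def m_def)
  qed
qed

text \<open>Bounded functionals are linear and continuous along dominated limits, so agreement
  spreads from indicators to simple functions and on to all integrable functions.\<close>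

lemma L1_dual_eqI_indicator:
  assumes l: "l \<in> L1_dual M" and m: "m \<in> L1_dual M"
    and ind: "\<And>A. A \<in> sets M \<Longrightarrow> l (indicator A) = m (indicator A)"
    and "integrable M \<phi>"
  shows "l \<phi> = m \<phi>"
  using \<open>integrable M \<phi>\<close>
proof (induction \<phi> rule: integrable_induct)
  case (base A c)
  then have int: "integrable M (indicator A :: _ \<Rightarrow> real)"
    by simp
  show ?case
    using L1_dual_scale[OF l int, of c] L1_dual_scale[OF m int, of c] ind[OF base(1)]
    by (simp add: mult.commute)
next
  case (add f g)
  then show ?case
    by (simp add: L1_dual_add[OF l] L1_dual_add[OF m])
next
  case (lim f s)
  \<comment> \<open>The induction rule bounds the approximants by twice the absolute value of their
    limit, hence the factor 2.\<close>
  have w: "integrable M (\<lambda>x. 2 * \<bar>f x\<bar>)"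
    using lim(4) by simp
  have bound: "\<bar>s i x\<bar> \<le> 2 * \<bar>f x\<bar>" if "x \<in> space M" for i x
    using lim(3)[OF that] by simp
  have "(\<lambda>i. l (s i)) \<longlonglongrightarrow> l f"
    by (rule L1_dual_dominated_convergence[OF l lim(1,4) w lim(2) bound])
  moreover have "(\<lambda>i. l (s i)) \<longlonglongrightarrow> m f"
    unfolding lim(5) by (rule L1_dual_dominated_convergence[OF m lim(1,4) w lim(2) bound])
  ultimately show ?case
    by (rule LIMSEQ_unique)
qed

text \<open>This is the duality of \<open>L^1\<close> and \<open>L^\<infinity>\<close>: the
  Radon-Nikodym density of the shifted measure, minus the shift, represents
  \<open>l\<close>.\<close>

lemma L1_dual_representation:
  assumes l: "l \<in> L1_dual M"
  obtains g K where "g \<in> borel_measurable M" "\<And>x. \<bar>g x\<bar> \<le> K"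
    "\<And>\<phi>. integrable M \<phi> \<Longrightarrow> l \<phi> = density_functional M g \<phi>"
proof -
  obtain C where C: "0 \<le> C" and bound: "\<And>\<phi>. integrable M \<phi> \<Longrightarrow> \<bar>l \<phi>\<bar> \<le> C * L1_norm M \<phi>"
    using l by (rule L1_dual_bound) blast
  obtain N where N: "finite_measure N" and sets_N: "sets N = sets M"
    and meas_N: "\<And>A. A \<in> sets M \<Longrightarrow> measure N A = l (indicator A) + C * measure M A"
    using L1_dual_shifted_measure[OF l C bound] by blast
  interpret N: finite_measure N by fact
  \<comment> \<open>The bound is used twice: it makes \<open>N\<close> absolutely continuous, and it
    caps the density of \<open>N\<close>.\<close>
  have N_le: "measure N A \<le> 2 * C * measure M A" if "A \<in> sets M" for A
  proof -
    have "\<bar>l (indicator A)\<bar> \<le> C * measure M A"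
      using bound that by (rule L1_dual_indicator_lipschitz)
    then show ?thesis using meas_N[OF that] by linarith
  qed
  have ac: "absolutely_continuous M N"
    unfolding absolutely_continuous_def
  proof
    fix A assume A: "A \<in> null_sets M"
    then have "A \<in> sets M" "measure M A = 0"
      by (simp_all add: null_setsD1 null_setsD2 measure_def)
    with N_le[of A] have "measure N A = 0"
      using measure_nonneg[of N A] by simp
    then show "A \<in> null_sets N"
      using \<open>A \<in> sets M\<close> sets_N by (simp add: null_sets_def N.emeasure_eq_measure)
  qed
  define g where "g x = enn2real (RN_deriv M N x)" for x
  have g_meas[measurable]: "g \<in> borel_measurable M" unfolding g_def by measurable
  have g_ind: "integrable M (\<lambda>x. g x * indicator A x)" "(\<integral>x. g x * indicator A x \<partial>M) = measure N A"
    if A: "A \<in> sets M" for A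
  proof -
    have AN: "A \<in> sets N" using A sets_N by simp
    have "integrable N (indicator A :: _ \<Rightarrow> real)"
      using AN by (simp add: N.emeasure_finite less_top[symmetric])
    with A show "integrable M (\<lambda>x. g x * indicator A x)"
      using RN_deriv_integrable[OF N.sigma_finite_measure_axioms ac sets_N, of "indicator A"]
      by (simp add: g_def)
    show "(\<integral>x. g x * indicator A x \<partial>M) = measure N A"
      using RN_deriv_integral[OF N.sigma_finite_measure_axioms ac sets_N, of "indicator A"] A AN
        sets.sets_into_space[OF AN]
      by (simp add: g_def Int_absorb2)
  qed
  have g_int: "integrable M g"
  proof -
    have "integrable M g \<longleftrightarrow> integrable M (\<lambda>x. g x * indicator (space M) x)"
      by (rule Bochner_Integration.integrable_cong) auto
    then show ?thesis using g_ind(1)[of "space M"] by simp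
  qed
  \<comment> \<open>All averages of \<open>g\<close> over sets of positive measure lie in the closed
    half-line, so almost all values of \<open>g\<close> do.\<close>
  have g_le: "AE x in M. g x \<in> {..2 * C}"
  proof (rule averaging_theorem[OF g_int])
    fix A assume A: "A \<in> sets M" and pos: "0 < measure M A"
    have "set_lebesgue_integral M A g = measure N A"
      using g_ind(2)[OF A] by (simp add: set_lebesgue_integral_def mult.commute)
    then show "(1 / measure M A) *\<^sub>R set_lebesgue_integral M A g \<in> {..2 * C}"
      using N_le[OF A] pos by (simp add: field_simps)
  qed simp
  \<comment> \<open>Truncation changes \<open>g\<close> only on a null set and makes the bound hold
    everywhere; subtracting \<open>C\<close> removes the shift and centres the interval
    \<open>[0, 2 * C]\<close> at zero.\<close>
  define g' where "g' x = min (g x) (2 * C) - C" for x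
  have g'_meas[measurable]: "g' \<in> borel_measurable M" unfolding g'_def by measurable
  have g'_bound: "\<bar>g' x\<bar> \<le> C" for x
    using C enn2real_nonneg[of "RN_deriv M N x"] by (auto simp: g'_def g_def min_def abs_le_iff)
  show ?thesis
  proof (rule that[OF g'_meas g'_bound])
    have dual: "density_functional M g' \<in> L1_dual M"
      by (rule density_functional_L1_dual) (use g'_bound in auto)
    fix \<phi> :: "'a \<Rightarrow> real" assume \<phi>: "integrable M \<phi>"
    show "l \<phi> = density_functional M g' \<phi>"
    proof (rule L1_dual_eqI_indicator[OF l dual _ \<phi>])
      fix A assume A: "A \<in> sets M"
      have "density_functional M g' (indicator A)
          = (\<integral>x. g x * indicator A x - C * indicator A x \<partial>M)"
        unfolding density_functional_def
      proof (rule integral_cong_AE)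
        show "AE x in M. g' x * indicator A x = g x * indicator A x - C * indicator A x"
          using g_le by eventually_elim (auto simp: g'_def min_def algebra_simps)
      qed (use A in measurable)
      also have "\<dots> = measure N A - C * measure M A"
        using g_ind[OF A] A sets.sets_into_space[OF A]
        by (simp add: Int_absorb2 emeasure_finite less_top[symmetric])
      finally show "l (indicator A) = density_functional M g' (indicator A)"
        using meas_N[OF A] by simp
    qed
  qed
qed

end

section \<open>Bidual estimates and uniform approximation\<close>

text \<open>The dual norm is a supremum of reals, so it is controlled only for a nonempty bounded
  family: the zero function lies in the unit ball, and \<open>e\<close> is an upper bound
  there.\<close>

lemma L1_dual_norm_le:
  assumes l: "l \<in> L1_dual M" and e: "0 \<le> e"
    and bound: "\<And>\<phi>. integrable M \<phi> \<Longrightarrow> \<bar>l \<phi>\<bar> \<le> e * L1_norm M \<phi>"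
  shows "0 \<le> L1_dual_norm M l" "L1_dual_norm M l \<le> e"
proof -
  let ?B = "{\<phi>. integrable M \<phi> \<and> L1_norm M \<phi> \<le> 1}"
  have zero: "(\<lambda>_. 0) \<in> ?B" by (simp add: L1_norm_def)
  have le: "\<bar>l \<phi>\<bar> \<le> e" if "\<phi> \<in> ?B" for \<phi>
    using bound[of \<phi>] mult_left_mono[of "L1_norm M \<phi>" 1 e] e that by simp
  have "0 \<le> \<bar>l (\<lambda>_. 0)\<bar>" by simp
  also have "\<dots> \<le> L1_dual_norm M l"
    unfolding L1_dual_norm_def by (rule cSUP_upper[OF zero]) (use le in \<open>auto intro!: bdd_aboveI2\<close>)
  finally show "0 \<le> L1_dual_norm M l" .
  show "L1_dual_norm M l \<le> e"
    unfolding L1_dual_norm_def by (rule cSUP_least) (use zero le in auto)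
qed

lemma L1_bidual_linear:
  assumes "\<xi> \<in> L1_bidual M" "l \<in> L1_dual M" "m \<in> L1_dual M"
  shows "\<xi> (\<lambda>\<phi>. a * l \<phi> + b * m \<phi>) = a * \<xi> l + b * \<xi> m"
  using assms by (simp add: L1_bidual_def)

text \<open>Any explicit bound \<open>e\<close> for \<open>l\<close> can stand in for the dual norm,
  so that later estimates avoid the supremum.\<close>

lemma L1_bidual_bound:
  assumes \<xi>: "\<xi> \<in> L1_bidual M"
  obtains C where "0 \<le> C"
    "\<And>l e. l \<in> L1_dual M \<Longrightarrow> 0 \<le> e \<Longrightarrow> (\<And>\<phi>. integrable M \<phi> \<Longrightarrow> \<bar>l \<phi>\<bar> \<le> e * L1_norm M \<phi>)
      \<Longrightarrow> \<bar>\<xi> l\<bar> \<le> C * e"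
proof -
  obtain C where C: "\<And>l. l \<in> L1_dual M \<Longrightarrow> \<bar>\<xi> l\<bar> \<le> C * L1_dual_norm M l"
    using \<xi> unfolding L1_bidual_def by blast
  have "\<bar>\<xi> l\<bar> \<le> \<bar>C\<bar> * e" if l: "l \<in> L1_dual M" and e: "0 \<le> e"
    and bound: "\<And>\<phi>. integrable M \<phi> \<Longrightarrow> \<bar>l \<phi>\<bar> \<le> e * L1_norm M \<phi>" for l e
  proof -
    have n: "0 \<le> L1_dual_norm M l" "L1_dual_norm M l \<le> e"
      using L1_dual_norm_le[OF l e] bound by blast+
    have "\<bar>\<xi> l\<bar> \<le> C * L1_dual_norm M l" by (rule C[OF l])
    also have "\<dots> \<le> \<bar>C\<bar> * e" using n by (intro mult_mono) auto
    finally show ?thesis .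
  qed
  then show ?thesis by (intro that[of "\<bar>C\<bar>"]) auto
qed

text \<open>As functions, \<open>l\<close> and \<open>m\<close> may differ outside the integrable
  functions. On these their difference has bound 0, and a bounded linear \<open>\<xi>\<close> sends
  it to 0.\<close>

lemma L1_bidual_cong:
  assumes \<xi>: "\<xi> \<in> L1_bidual M" and l: "l \<in> L1_dual M" and m: "m \<in> L1_dual M"
    and eq: "\<And>\<phi>. integrable M \<phi> \<Longrightarrow> l \<phi> = m \<phi>"
  shows "\<xi> l = \<xi> m"
proof -
  obtain C where C: "\<And>l e. l \<in> L1_dual M \<Longrightarrow> 0 \<le> e \<Longrightarrow>
      (\<And>\<phi>. integrable M \<phi> \<Longrightarrow> \<bar>l \<phi>\<bar> \<le> e * L1_norm M \<phi>) \<Longrightarrow> \<bar>\<xi> l\<bar> \<le> C * e"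
    using \<xi> by (rule L1_bidual_bound) blast
  have "\<bar>\<xi> (\<lambda>\<phi>. 1 * l \<phi> + (-1) * m \<phi>)\<bar> \<le> C * 0"
    by (rule C[OF L1_dual_lincomb[OF l m]]) (use eq in auto)
  then show ?thesis
    unfolding L1_bidual_linear[OF \<xi> l m] by simp
qed

text \<open>The values \<open>\<lfloor>n u\<rfloor> / n\<close> approximate \<open>u\<close> uniformly within \<open>1 / n\<close>.\<close>

lemma bounded_measurable_induct_nonneg [consumes 3, case_names set mult add uniform]:
  fixes u :: "'x \<Rightarrow> real"
  assumes u: "u \<in> borel_measurable M" and nn: "\<And>x. 0 \<le> u x" and K: "\<And>x. u x \<le> K"
  assumes set: "\<And>A. A \<in> sets M \<Longrightarrow> P (indicator A)"
  assumes mult: "\<And>u c. P u \<Longrightarrow> P (\<lambda>x. c * u x)"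
  assumes add: "\<And>u v. P u \<Longrightarrow> P v \<Longrightarrow> P (\<lambda>x. u x + v x)"
  assumes uniform: "\<And>u. u \<in> borel_measurable M \<Longrightarrow> (\<And>x. \<bar>u x\<bar> \<le> K) \<Longrightarrow>
    (\<And>e. 0 < e \<Longrightarrow> \<exists>v. P v \<and> (\<forall>x\<in>space M. \<bar>u x - v x\<bar> \<le> e)) \<Longrightarrow> P u"
  shows "P u"
proof (rule uniform[OF u])
  show "\<bar>u x\<bar> \<le> K" for x using nn[of x] K[of x] by simp
  fix e :: real assume e: "0 < e"
  define n where "n = nat \<lceil>1 / e\<rceil>"
  have n: "1 / e \<le> real n" unfolding n_def by linarith
  have n_pos: "0 < real n" using e n by (meson less_le_trans zero_less_divide_1_iff)
  define i where "i x = nat \<lfloor>real n * u x\<rfloor>" for x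
  have i_meas: "{x \<in> space M. i x = j} \<in> sets M" for j
    unfolding i_def using u by measurable
  \<comment> \<open>As \<open>u\<close> is at most \<open>K\<close>, the level of each point of the
    space is among the summation indices, and exactly one indicator is nonzero there. Outside the
    space \<open>v\<close> is 0, so the comparison is confined to \<open>space M\<close>.\<close>
  define v where "v x = (\<Sum>j\<le>nat \<lfloor>real n * K\<rfloor>. (real j / real n) * indicator {x \<in> space M. i x = j} x)" for x
  have sum: "P (\<lambda>x. \<Sum>j\<le>J. d j x)" if "\<And>j. P (d j)" for J :: nat and d
    by (induction J) (use that in \<open>auto intro: add\<close>)
  have P: "P v"
    unfolding v_def by (intro sum mult set i_meas)
  have v: "v x = real (i x) / real n" if x: "x \<in> space M" for x
  proof -
    have "i x \<le> nat \<lfloor>real n * K\<rfloor>"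
      unfolding i_def using K[of x] n_pos by (intro nat_mono floor_mono) auto
    have "v x = (\<Sum>j\<le>nat \<lfloor>real n * K\<rfloor>. if j = i x then real j / real n else 0)"
      unfolding v_def by (rule sum.cong) (use x in \<open>auto simp: indicator_def\<close>)
    also have "\<dots> = real (i x) / real n"
      using \<open>i x \<le> _\<close> by simp
    finally show ?thesis .
  qed
  have "\<bar>u x - v x\<bar> \<le> e" if x: "x \<in> space M" for x
  proof -
    \<comment> \<open>Nonnegativity keeps \<open>nat\<close> from altering the floor.\<close>
    have "0 \<le> real n * u x" using nn[of x] n_pos by simp
    then have "real (i x) \<le> real n * u x" "real n * u x \<le> real (i x) + 1"
      unfolding i_def by linarith+
    then have "\<bar>real n * u x - real (i x)\<bar> / real n \<le> 1 / real n"
      using n_pos by (intro divide_right_mono) auto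
    moreover have "u x - v x = (real n * u x - real (i x)) / real n"
      using n_pos by (simp add: v[OF x] field_simps)
    ultimately have "\<bar>u x - v x\<bar> \<le> 1 / real n"
      by (simp add: abs_divide)
    also have "\<dots> \<le> e" using n n_pos e by (simp add: field_simps)
    finally show ?thesis .
  qed
  with P show "\<exists>v. P v \<and> (\<forall>x\<in>space M. \<bar>u x - v x\<bar> \<le> e)" by blast
qed

section \<open>Bidual elements that come from integrable functions\<close>

context finite_measure
begin

text \<open>An element of the bidual acts on bounded densities like a finitely additive signed
  measure, and \<open>ind\<close> excludes a singular part. Both \<open>\<xi>\<close> and
  integration against \<open>h\<close> are continuous in the sup norm of the density, and
  \<open>L1_dual_representation\<close> provides a bounded density for every
  \<open>l\<close>.\<close>

theorem L1_bidual_eq_canonical_J: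
  assumes \<xi>: "\<xi> \<in> L1_bidual M" and h: "integrable M h"
    and ind: "\<And>A. A \<in> sets M \<Longrightarrow> \<xi> (indicator_functional M A) = (\<integral>x. indicator A x * h x \<partial>M)"
    and l: "l \<in> L1_dual M"
  shows "\<xi> l = canonical_J h l"
proof -
  \<comment> \<open>Measurability and an everywhere valid bound travel with the equality, so that
    linearity of \<open>\<xi>\<close> applies to every density built in the induction.\<close>
  define good where "good u \<longleftrightarrow> u \<in> borel_measurable M \<and> (\<exists>K. \<forall>x. \<bar>u x\<bar> \<le> K) \<and>
    \<xi> (density_functional M u) = density_functional M u h" for u
  have dual: "density_functional M u \<in> L1_dual M"
    if "u \<in> borel_measurable M" "\<exists>K. \<forall>x. \<bar>u x\<bar> \<le> K" for u
    using that by (blast intro: density_functional_L1_dual AE_I2)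
  have lincomb: "density_functional M (\<lambda>x. a * u x + b * v x) \<phi>
      = a * density_functional M u \<phi> + b * density_functional M v \<phi>"
    if u: "u \<in> borel_measurable M" "\<exists>K. \<forall>x. \<bar>u x\<bar> \<le> K"
      and v: "v \<in> borel_measurable M" "\<exists>K. \<forall>x. \<bar>v x\<bar> \<le> K"
      and \<phi>: "integrable M \<phi>" for u v a b \<phi>
  proof -
    have i: "integrable M (\<lambda>x. u x * \<phi> x)" "integrable M (\<lambda>x. v x * \<phi> x)"
      using u v \<phi> by (auto intro: integrable_bounded_mult)
    have "density_functional M (\<lambda>x. a * u x + b * v x) \<phi>
        = (\<integral>x. a * (u x * \<phi> x) + b * (v x * \<phi> x) \<partial>M)"
      by (simp add: density_functional_def algebra_simps)
    then show ?thesis using i by (simp add: density_functional_def)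
  qed
  have bdd: "\<exists>K. \<forall>x. \<bar>a * u x + b * v x\<bar> \<le> K"
    if u: "\<exists>K. \<forall>x. \<bar>u x\<bar> \<le> K" and v: "\<exists>K. \<forall>x. \<bar>v x\<bar> \<le> K" for u v :: "'a \<Rightarrow> real" and a b
  proof -
    obtain K1 K2 where K: "\<And>x. \<bar>u x\<bar> \<le> K1" "\<And>x. \<bar>v x\<bar> \<le> K2" using u v by blast
    have "\<bar>a * u x + b * v x\<bar> \<le> \<bar>a\<bar> * K1 + \<bar>b\<bar> * K2" for x
    proof -
      have "\<bar>a * u x + b * v x\<bar> \<le> \<bar>a\<bar> * \<bar>u x\<bar> + \<bar>b\<bar> * \<bar>v x\<bar>"
        by (metis abs_mult abs_triangle_ineq)
      also have "\<dots> \<le> \<bar>a\<bar> * K1 + \<bar>b\<bar> * K2"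
        by (intro add_mono mult_left_mono K abs_ge_zero)
      finally show ?thesis .
    qed
    then show ?thesis by blast
  qed
  have \<xi>_lincomb: "\<xi> (density_functional M (\<lambda>x. a * u x + b * v x))
      = a * \<xi> (density_functional M u) + b * \<xi> (density_functional M v)"
    if u: "u \<in> borel_measurable M" "\<exists>K. \<forall>x. \<bar>u x\<bar> \<le> K"
      and v: "v \<in> borel_measurable M" "\<exists>K. \<forall>x. \<bar>v x\<bar> \<le> K" for u v a b
  proof -
    \<comment> \<open>The two functionals are known to agree on integrable functions only; elsewhere
      an integral may take the default value 0. Hence the detour through
      \<open>L1_bidual_cong\<close>.\<close>
    have "\<xi> (density_functional M (\<lambda>x. a * u x + b * v x))
        = \<xi> (\<lambda>\<phi>. a * density_functional M u \<phi> + b * density_functional M v \<phi>)"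
    proof (rule L1_bidual_cong[OF \<xi> _ L1_dual_lincomb[OF dual[OF u] dual[OF v]]])
      show "density_functional M (\<lambda>x. a * u x + b * v x) \<in> L1_dual M"
      proof (rule dual)
        show "(\<lambda>x. a * u x + b * v x) \<in> borel_measurable M"
          using u(1) v(1) by simp
      qed (rule bdd[OF u(2) v(2)])
    qed (rule lincomb[OF u v])
    then show ?thesis
      using L1_bidual_linear[OF \<xi> dual[OF u] dual[OF v]] by simp
  qed
  have good_lincomb: "good (\<lambda>x. a * u x + b * v x)" if "good u" "good v" for a b u v
  proof -
    have u: "u \<in> borel_measurable M" "\<exists>K. \<forall>x. \<bar>u x\<bar> \<le> K"
      and v: "v \<in> borel_measurable M" "\<exists>K. \<forall>x. \<bar>v x\<bar> \<le> K"
      using that unfolding good_def by blast+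
    have "(\<lambda>x. a * u x + b * v x) \<in> borel_measurable M"
      using u(1) v(1) by simp
    moreover have "\<xi> (density_functional M (\<lambda>x. a * u x + b * v x))
        = density_functional M (\<lambda>x. a * u x + b * v x) h"
      unfolding \<xi>_lincomb[OF u v] lincomb[OF u v h] using that by (simp add: good_def)
    ultimately show ?thesis
      unfolding good_def using bdd[OF u(2) v(2)] by blast
  qed
  have good_ind: "good (indicator A)" if "A \<in> sets M" for A
  proof -
    have "\<forall>x. \<bar>indicator A x :: real\<bar> \<le> 1" by (auto simp: indicator_def)
    then show ?thesis
      using that ind[OF that] unfolding good_def indicator_functional_eq
      by (auto simp: density_functional_def)
  qed
  obtain C where C: "0 \<le> C" and \<xi>_bound: "\<And>l e. l \<in> L1_dual M \<Longrightarrow> 0 \<le> e \<Longrightarrow>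
      (\<And>\<phi>. integrable M \<phi> \<Longrightarrow> \<bar>l \<phi>\<bar> \<le> e * L1_norm M \<phi>) \<Longrightarrow> \<bar>\<xi> l\<bar> \<le> C * e"
    using \<xi> by (rule L1_bidual_bound) blast
  have good: "good u" if "u \<in> borel_measurable M" "\<And>x. 0 \<le> u x" "\<And>x. u x \<le> K" for u K
    using that
  proof (induction rule: bounded_measurable_induct_nonneg)
    case (set A)
    then show ?case by (rule good_ind)
  next
    case (mult u c)
    then show ?case using good_lincomb[of u u c 0] by simp
  next
    case (add u v)
    then show ?case using good_lincomb[of u v 1 1] by simp
  next
    case (uniform u)
    have "\<bar>\<xi> (density_functional M u) - density_functional M u h\<bar> \<le> 0 + e" if e: "0 < e" for e
    proof -
      \<comment> \<open>This makes \<open>C * d + d * L1_norm M h\<close> at most \<open>e\<close>;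
        the summand 1 keeps the denominator positive.\<close>
      define d where "d = e / (C + L1_norm M h + 1)"
      have pos: "0 < C + L1_norm M h + 1" using C L1_norm_nonneg[of M h] by linarith
      then have d: "0 < d" using e by (simp add: d_def)
      obtain v where v: "good v" "\<forall>x\<in>space M. \<bar>u x - v x\<bar> \<le> d" using uniform(3)[OF d] by blast
      have u': "u \<in> borel_measurable M" "\<exists>K. \<forall>x. \<bar>u x\<bar> \<le> K"
        using uniform(1,2) by blast+
      have v': "v \<in> borel_measurable M" "\<exists>K. \<forall>x. \<bar>v x\<bar> \<le> K"
        using v(1) unfolding good_def by blast+
      let ?w = "\<lambda>x. 1 * u x + (-1) * v x"
      have w: "?w \<in> borel_measurable M" "AE x in M. \<bar>?w x\<bar> \<le> d"
        using u' v' v(2) by auto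
      have "\<bar>\<xi> (density_functional M ?w)\<bar> \<le> C * d"
        using d by (intro \<xi>_bound density_functional_L1_dual[OF w] density_functional_bound[OF w]) auto
      moreover have "\<bar>density_functional M ?w h\<bar> \<le> d * L1_norm M h"
        by (rule density_functional_bound[OF w h])
      moreover have "\<xi> (density_functional M v) = density_functional M v h"
        using v(1) by (simp add: good_def)
      ultimately have "\<bar>\<xi> (density_functional M u) - density_functional M u h\<bar>
          \<le> C * d + d * L1_norm M h"
        unfolding \<xi>_lincomb[OF u' v'] lincomb[OF u' v' h] by linarith
      also have "\<dots> \<le> d * (C + L1_norm M h + 1)" using d by (simp add: algebra_simps)
      also have "\<dots> = e" using pos by (simp add: d_def)
      finally show ?thesis by simp
    qed
    then have "\<bar>\<xi> (density_functional M u) - density_functional M u h\<bar> \<le> 0"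
      by (rule field_le_epsilon)
    then show ?case
      unfolding good_def using uniform(1,2) by auto
  qed
  obtain g K where g: "g \<in> borel_measurable M" "\<And>x. \<bar>g x\<bar> \<le> K"
    and rep: "\<And>\<phi>. integrable M \<phi> \<Longrightarrow> l \<phi> = density_functional M g \<phi>"
    using L1_dual_representation[OF l] by blast
  \<comment> \<open>The approximation covers nonnegative functions, so \<open>g\<close> is lifted
    into \<open>[0, 2 * K]\<close> and the constant is subtracted again by linearity.\<close>
  have "good (\<lambda>x. g x + K)"
  proof (rule good)
    show "0 \<le> g x + K" "g x + K \<le> 2 * K" for x using g(2)[of x] by linarith+
  qed (use g in auto)
  moreover have "good (\<lambda>_. 1)"
    by (rule good[where K = 1]) auto
  ultimately have "good (\<lambda>x. 1 * (g x + K) + (- K) * 1)"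
    by (rule good_lincomb)
  then have "good g" by simp
  have "\<xi> l = \<xi> (density_functional M g)"
    using g by (intro L1_bidual_cong[OF \<xi> l dual] rep) auto
  then show ?thesis
    using \<open>good g\<close> rep[OF h] by (simp add: good_def canonical_J_def)
qed

end

section \<open>The transposed operator and the eigenvalue equation\<close>

text \<open>\<open>L\<close> is linear only up to null sets, which \<open>L1_dual_cong_AE\<close>
  absorbs. The result allows a representation of \<open>\<xi>\<close> on the dual to be applied to
  \<open>transpose_op L l\<close>.\<close>

lemma transpose_op_L1_dual:
  assumes L: "is_L1_extension M T L" and l: "l \<in> L1_dual M"
  shows "transpose_op L l \<in> L1_dual M"
proof -
  have int: "integrable M (L \<phi>)" if "integrable M \<phi>" for \<phi>
    using L that by (simp add: is_L1_extension_def)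
  obtain C where C: "0 \<le> C" "\<And>\<phi>. integrable M \<phi> \<Longrightarrow> \<bar>l \<phi>\<bar> \<le> C * L1_norm M \<phi>"
    using l by (rule L1_dual_bound) blast
  have "\<exists>K. \<forall>\<phi>. integrable M \<phi> \<longrightarrow> L1_norm M (L \<phi>) \<le> K * L1_norm M \<phi>"
    using L by (simp add: is_L1_extension_def)
  then obtain K where K: "\<And>\<phi>. integrable M \<phi> \<Longrightarrow> L1_norm M (L \<phi>) \<le> K * L1_norm M \<phi>"
    by blast
  have "l (L (\<lambda>x. a * \<phi> x + b * \<psi> x)) = a * l (L \<phi>) + b * l (L \<psi>)"
    if \<phi>: "integrable M \<phi>" and \<psi>: "integrable M \<psi>" for a b \<phi> \<psi>
  proof -
    have "l (L (\<lambda>x. a * \<phi> x + b * \<psi> x)) = l (\<lambda>x. a * L \<phi> x + b * L \<psi> x)"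
    proof (rule L1_dual_cong_AE[OF l])
      show "AE x in M. L (\<lambda>x. a * \<phi> x + b * \<psi> x) x = a * L \<phi> x + b * L \<psi> x"
        using L \<phi> \<psi> by (simp add: is_L1_extension_def)
    qed (use int \<phi> \<psi> in auto)
    then show ?thesis
      using L1_dual_linear[OF l int[OF \<phi>] int[OF \<psi>]] by simp
  qed
  then have "\<forall>\<phi> \<psi> a b. integrable M \<phi> \<longrightarrow> integrable M \<psi> \<longrightarrow>
      l (L (\<lambda>x. a * \<phi> x + b * \<psi> x)) = a * l (L \<phi>) + b * l (L \<psi>)"
    by simp
  moreover have "\<bar>l (L \<phi>)\<bar> \<le> (C * K) * L1_norm M \<phi>" if "integrable M \<phi>" for \<phi>
  proof -
    have "\<bar>l (L \<phi>)\<bar> \<le> C * L1_norm M (L \<phi>)" by (rule C(2)[OF int[OF that]])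
    also have "\<dots> \<le> C * (K * L1_norm M \<phi>)" by (rule mult_left_mono[OF K[OF that] C(1)])
    finally show ?thesis by simp
  qed
  then have "\<exists>B. \<forall>\<phi>. integrable M \<phi> \<longrightarrow> \<bar>l (L \<phi>)\<bar> \<le> B * L1_norm M \<phi>"
    by blast
  ultimately show ?thesis
    by (simp add: L1_dual_def transpose_op_def)
qed

text \<open>For a null set \<open>A\<close> the functional \<open>1_A M\<close> vanishes on every
  function, integrable or not, so it is literally the zero function and linearity of
  \<open>\<xi>\<close> gives the value 0.\<close>

lemma absolutely_continuous_if_bidual:
  fixes M \<mu> :: "'x measure"
  assumes \<mu>: "finite_measure \<mu>" and sets: "sets \<mu> = sets M" and \<xi>: "\<xi> \<in> L1_bidual M"
    and meas: "\<And>A. A \<in> sets M \<Longrightarrow> measure \<mu> A = \<xi> (indicator_functional M A)"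
  shows "absolutely_continuous M \<mu>"
  unfolding absolutely_continuous_def
proof
  fix A assume A: "A \<in> null_sets M"
  interpret \<mu>: finite_measure \<mu> by fact
  have "indicator_functional M A = (\<lambda>_. 0)"
  proof
    fix \<phi> :: "'x \<Rightarrow> real"
    have "AE x in M. x \<notin> A" by (rule AE_not_in[OF A])
    then have "AE x in M. indicator A x * \<phi> x = 0" by eventually_elim simp
    then show "indicator_functional M A \<phi> = 0"
      unfolding indicator_functional_def by (rule integral_eq_zero_AE)
  qed
  moreover have "\<xi> (\<lambda>_. 0) = 0"
    using L1_bidual_linear[OF \<xi> L1_dual_zero L1_dual_zero, of 0 0] by simp
  ultimately have "measure \<mu> A = 0"
    using meas[OF null_setsD2[OF A]] by simp
  then show "A \<in> null_sets \<mu>"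
    using null_setsD2[OF A] sets by (simp add: null_sets_def \<mu>.emeasure_eq_measure)
qed

theorem theorem4p2:
  fixes p :: "'a::metric_space measure"
    and f :: "(nat \<Rightarrow> 'a) \<Rightarrow> real"
    and \<nu> \<mu> :: "(nat \<Rightarrow> 'a) measure"
    and L :: "((nat \<Rightarrow> 'a) \<Rightarrow> real) \<Rightarrow> ((nat \<Rightarrow> 'a) \<Rightarrow> real)"
    and \<xi> :: "(((nat \<Rightarrow> 'a) \<Rightarrow> real) \<Rightarrow> real) \<Rightarrow> real"
    and D :: "'d set" and le :: "'d \<Rightarrow> 'd \<Rightarrow> bool" and k :: "'d \<Rightarrow> nat"
    and \<rho> :: real
  assumes "compact (UNIV :: 'a set)"
    and "prob_space p" and "sets p = sets borel" and "measure_support p = UNIV"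
    and "continuous_on UNIV f"
    and "\<rho> = spectral_radius (ruelle p f)"
    and "\<nu> \<in> eigenmeasures p f"
    and "is_L1_extension \<nu> (ruelle p f) L"
    and "L1_bidual_eigenvector \<nu> L \<rho> \<xi>"
    and "subnet_index D le k"
    and "weak_star_tendsto \<nu> (\<lambda>d. normalized_iterate \<rho> L (k d)) \<xi> (net_tails D le)"
    and "prob_space \<mu>" and "sets \<mu> = sets borel"
    and "\<forall>A\<in>sets borel. measure \<mu> A = \<xi> (indicator_functional \<nu> A)"
  shows "absolutely_continuous \<nu> \<mu> \<and>
         L1_eigenvector \<nu> L \<rho> (\<lambda>x. enn2real (RN_deriv \<nu> \<mu> x))"
proof -
  have \<nu>: "prob_space \<nu>" "sets \<nu> = sets borel"
    using assms(7) by (auto simp: eigenmeasures_def)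
  interpret \<nu>: prob_space \<nu> by fact
  interpret \<mu>: prob_space \<mu> by fact
  have sets: "sets \<mu> = sets \<nu>" using \<nu> assms(13) by simp
  have meas: "\<And>A. A \<in> sets \<nu> \<Longrightarrow> measure \<mu> A = \<xi> (indicator_functional \<nu> A)"
    using assms(14) \<nu>(2) by simp
  \<comment> \<open>Only the outer transpose is unfolded, so the argument stays an element of the
    dual.\<close>
  have \<xi>: "\<xi> \<in> L1_bidual \<nu>"
    and eig: "\<And>l. l \<in> L1_dual \<nu> \<Longrightarrow> \<xi> (transpose_op L l) = \<rho> * \<xi> l"
    using assms(9) by (simp_all add: L1_bidual_eigenvector_def transpose_op_def[of "transpose_op L"])
  have ac: "absolutely_continuous \<nu> \<mu>"
    by (rule absolutely_continuous_if_bidual[OF \<mu>.finite_measure_axioms sets \<xi> meas])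
  define h where "h x = enn2real (RN_deriv \<nu> \<mu> x)" for x
  note RN_integrable = \<nu>.RN_deriv_integrable[OF \<mu>.sigma_finite_measure_axioms ac sets]
  note RN_integral = \<nu>.RN_deriv_integral[OF \<mu>.sigma_finite_measure_axioms ac sets]
  have h_int: "integrable \<nu> h"
    using RN_integrable[of "\<lambda>_. 1"] by (simp add: h_def[abs_def])
  have h_total: "(\<integral>x. h x \<partial>\<nu>) = 1"
    using RN_integral[of "\<lambda>_. 1"] by (simp add: h_def \<mu>.prob_space)
  have h_ind: "(\<integral>x. indicator A x * h x \<partial>\<nu>) = measure \<mu> A" if A: "A \<in> sets \<nu>" for A
  proof -
    have "A \<in> sets \<mu>" using A sets by simp
    then show ?thesis
      using RN_integral[of "indicator A"] A sets.sets_into_space[of A \<mu>]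
      by (simp add: h_def mult.commute Int_absorb2)
  qed
  have J: "\<xi> l = canonical_J h l" if "l \<in> L1_dual \<nu>" for l
    by (rule \<nu>.L1_bidual_eq_canonical_J[OF \<xi> h_int _ that]) (simp add: h_ind meas)
  have Lh_int: "integrable \<nu> (L h)"
    using assms(8) h_int by (simp add: is_L1_extension_def)
  \<comment> \<open>Integrable functions with equal integrals over all measurable sets coincide
    almost everywhere.\<close>
  have "AE x in \<nu>. L h x = \<rho> * h x"
  proof (rule density_unique_real)
    fix A assume A: "A \<in> sets \<nu>"
    have dual: "indicator_functional \<nu> A \<in> L1_dual \<nu>"
      unfolding indicator_functional_eq
      by (rule density_functional_L1_dual[where K = 1]) (use A in \<open>auto simp: indicator_def\<close>)
    \<comment> \<open>Replacing \<open>\<xi>\<close> by \<open>canonical_J h\<close> on both sides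
      of the eigenvalue equation turns it into \<open>l (L h) = \<rho> * l h\<close> for
      \<open>l = indicator_functional \<nu> A\<close>.\<close>
    have "indicator_functional \<nu> A (L h) = \<rho> * indicator_functional \<nu> A h"
      using eig[OF dual] J[OF dual] J[OF transpose_op_L1_dual[OF assms(8) dual]]
      by (simp add: canonical_J_def transpose_op_def)
    then show "(\<integral>x\<in>A. L h x \<partial>\<nu>) = (\<integral>x\<in>A. \<rho> * h x \<partial>\<nu>)"
      by (simp add: indicator_functional_def set_lebesgue_integral_def mult.left_commute)
  qed (use Lh_int h_int in auto)
  \<comment> \<open>A density vanishing almost everywhere would have integral 0, whereas
    \<open>\<mu>\<close> has total mass 1.\<close>
  moreover have "\<not> (AE x in \<nu>. h x = 0)"
    using h_total integral_eq_zero_AE[of h \<nu>] by auto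
  ultimately have "L1_eigenvector \<nu> L \<rho> h"
    using h_int by (simp add: L1_eigenvector_def)
  with ac show ?thesis
    by (simp add: h_def[abs_def])
qed

end
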